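(* Let $(\lambda_s^*,\pi_s^* )_{s\in S}$ be an optimal splitting of $\pi^\circ$ and let $\Pi^*=\{\pi_s^*:s\in S\}$. Then there exist $\pi_p\in\mathrm{co}\,\Pi^*$ and $\alpha_p\in BR(\pi_p)$ such that $u(\alpha_p,\pi_s^* )\le\overline{u}(\pi_s^* )$ for all $\pi_s^*\in\Pi^*$.
   Context: $\Omega$ (states) and $A$ (actions) are finite non-empty sets; $\pi^\circ\in\Delta(\Omega)$ is a prior; $u,v:A\times\Omega\to\mathbb{R}$ are the payoff functions of an expert and of a decision-maker, respectively. $\Delta(X)$ is the set of probability distributions on $X$. Payoffs are extended linearly: $u(\alpha,\pi)=\sum_{a,\omega}\alpha(a)\pi(\omega)u(a,\omega)$ for $\alpha\in\Delta(A)$, $\pi\in\Delta(\Omega)$, and likewise $v(\alpha,\pi)$. $BR(\pi)=\{\alpha\in\Delta(A): v(\alpha,\pi)\ge v(\alpha',\pi)\ \forall \alpha'\in\Delta(A)\}$ is the set of the decision-maker's best-replies at belief $\pi$. $\overline{u}(\pi)=\max_{\alpha\in BR(\pi)}u(\alpha,\pi)$, and $\mathrm{cav}\,\overline{u}$ is the concavification of $\overline{u}$, i.e. the smallest concave function on $\Delta(\Omega)$ that is pointwise $\ge\overline{u}$. An optimal splitting of $\pi^\circ$ is a family $(\lambda_s^*,\pi_s^* )_{s\in S}$, indexed by a finite set $S$ of signals, where $(\lambda_s^* )_{s\in S}$ are probability weights ($\lambda_s^*\ge 0$, $\sum_{s\in S}\lambda_s^*=1$) and $\pi_s^*\in\Delta(\Omega)$,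 such that $\sum_{s\in S}\lambda_s^*\pi_s^*=\pi^\circ$ and $\sum_{s\in S}\lambda_s^*\overline{u}(\pi_s^* )=\mathrm{cav}\,\overline{u}(\pi^\circ)$. $\mathrm{co}$ denotes convex hull.
   Formalization: Π* is taken to be the set of posteriors π_s* of signals with λ_s* > 0, both in co Π* and in the final inequality; with zero-weight signals included the claim is false (matching decision-maker, mismatching expert, degenerate prior). *)

theory Defs
  imports "HOL-Analysis.Analysis"
begin

text \<open>States and actions are the elements of types of class \<open>finite\<close> (hence non-empty);
  a distribution over them is its vector of probabilities.\<close>

definition prob_simplex :: "(real ^ 'n) set" where
  "prob_simplex = {p. (\<forall>i. 0 \<le> p $ i) \<and> (\<Sum>i\<in>UNIV. p $ i) = 1}"

definition payoff :: "('a::finite \<Rightarrow> 'w::finite \<Rightarrow> real) \<Rightarrow> real ^ 'a \<Rightarrow> real ^ 'w \<Rightarrow> real" where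
  "payoff u \<alpha> \<pi> = (\<Sum>a\<in>UNIV. \<Sum>\<omega>\<in>UNIV. \<alpha> $ a * \<pi> $ \<omega> * u a \<omega>)"

definition BR :: "('a::finite \<Rightarrow> 'w::finite \<Rightarrow> real) \<Rightarrow> real ^ 'w \<Rightarrow> (real ^ 'a) set" where
  "BR v \<pi> = {\<alpha> \<in> prob_simplex. \<forall>\<alpha>'\<in>prob_simplex. payoff v \<alpha> \<pi> \<ge> payoff v \<alpha>' \<pi>}"

text \<open>The supremum is a maximum, see \<open>u_bar_attained\<close> below.\<close>

definition u_bar ::
    "('a::finite \<Rightarrow> 'w::finite \<Rightarrow> real) \<Rightarrow> ('a \<Rightarrow> 'w \<Rightarrow> real) \<Rightarrow> real ^ 'w \<Rightarrow> real" where
  "u_bar u v \<pi> = (SUP \<alpha>\<in>BR v \<pi>. payoff u \<alpha> \<pi>)"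

text \<open>The least concave majorant on the simplex, see \<open>cav_concave\<close>, \<open>cav_ge\<close> and
  \<open>cav_least\<close> below. Values of the functions outside the simplex are irrelevant.\<close>

definition cav :: "(real ^ 'w \<Rightarrow> real) \<Rightarrow> real ^ 'w \<Rightarrow> real" where
  "cav f \<pi> = Inf {g \<pi> | g. concave_on prob_simplex g \<and> (\<forall>\<rho>\<in>prob_simplex. f \<rho> \<le> g \<rho>)}"

definition optimal_splitting ::
    "('a::finite \<Rightarrow> 'w::finite \<Rightarrow> real) \<Rightarrow> ('a \<Rightarrow> 'w \<Rightarrow> real) \<Rightarrow> real ^ 'w \<Rightarrow>
     's set \<Rightarrow> ('s \<Rightarrow> real) \<Rightarrow> ('s \<Rightarrow> real ^ 'w) \<Rightarrow> bool" where
  "optimal_splitting u v \<pi>0 S l p \<longleftrightarrow>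
     finite S \<and> (\<forall>s\<in>S. 0 \<le> l s) \<and> (\<Sum>s\<in>S. l s) = 1 \<and>
     (\<forall>s\<in>S. p s \<in> prob_simplex) \<and>
     (\<Sum>s\<in>S. l s *\<^sub>R p s) = \<pi>0 \<and>
     (\<Sum>s\<in>S. l s * u_bar u v (p s)) = cav (u_bar u v) \<pi>0"

text \<open>Beliefs attached to signals of weight 0 are unconstrained by optimality, and the result
  fails for them: take two states and two actions, with the decision-maker preferring to match
  the state and the expert preferring a mismatch, a degenerate prior, and the other degenerate
  belief with weight 0. Hence only signals of positive weight count.\<close>

definition posteriors :: "'s set \<Rightarrow> ('s \<Rightarrow> real) \<Rightarrow> ('s \<Rightarrow> real ^ 'w) \<Rightarrow> (real ^ 'w) set" where
  "posteriors S l p = {p s | s. s \<in> S \<and> 0 < l s}"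

lemma posteriors_pos: "(\<And>s. s \<in> S \<Longrightarrow> 0 < l s) \<Longrightarrow> posteriors S l p = p ` S"
  by (auto simp: posteriors_def)

lemma prob_simplex_le_1: "p \<in> prob_simplex \<Longrightarrow> p $ i \<le> 1"
  unfolding prob_simplex_def
  by (metis (mono_tags, lifting) finite iso_tuple_UNIV_I mem_Collect_eq member_le_sum)

lemma convex_prob_simplex: "convex prob_simplex"
  by (auto simp: convex_def prob_simplex_def sum.distrib simp flip: sum_distrib_left)

lemma compact_prob_simplex: "compact (prob_simplex :: (real ^ 'n) set)"
proof -
  have "closed (prob_simplex :: (real ^ 'n) set)"
    unfolding prob_simplex_def
    by (intro closed_Collect_conj closed_Collect_all closed_Collect_le closed_Collect_eq
        continuous_intros)
  moreover have "prob_simplex \<subseteq> cbox 0 (1 :: real ^ 'n)"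
    by (auto simp: mem_box_cart prob_simplex_le_1) (auto simp: prob_simplex_def)
  ultimately show ?thesis
    by (meson bounded_cbox bounded_subset compact_eq_bounded_closed)
qed

lemma prob_simplex_nonempty: "(prob_simplex :: (real ^ 'n) set) \<noteq> {}"
proof -
  have "axis undefined 1 \<in> (prob_simplex :: (real ^ 'n) set)"
    by (auto simp: prob_simplex_def axis_def)
  then show ?thesis by blast
qed

lemma continuous_on_payoff: "continuous_on X (\<lambda>\<alpha>. payoff u \<alpha> \<pi>)"
  unfolding payoff_def by (intro continuous_intros)

lemma BR_nonempty: "BR v \<pi> \<noteq> {}"
  using continuous_attains_sup[OF compact_prob_simplex prob_simplex_nonempty continuous_on_payoff]
  unfolding BR_def by blast

lemma compact_BR: "compact (BR v \<pi>)"
proof -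
  have "BR v \<pi> = prob_simplex \<inter> {\<alpha>. \<forall>\<alpha>'. \<alpha>' \<in> prob_simplex \<longrightarrow> payoff v \<alpha>' \<pi> \<le> payoff v \<alpha> \<pi>}"
    by (auto simp: BR_def)
  moreover have "closed {\<alpha>. \<forall>\<alpha>'. \<alpha>' \<in> prob_simplex \<longrightarrow> payoff v \<alpha>' \<pi> \<le> payoff v \<alpha> \<pi>}"
    by (intro closed_Collect_all closed_Collect_imp open_Collect_const closed_Collect_le
        continuous_on_const continuous_on_payoff)
  ultimately show ?thesis
    by (simp add: compact_Int_closed compact_prob_simplex)
qed

lemma u_bar_attained:
  "\<exists>\<alpha>\<in>BR v \<pi>. payoff u \<alpha> \<pi> = u_bar u v \<pi> \<and> (\<forall>\<alpha>'\<in>BR v \<pi>. payoff u \<alpha>' \<pi> \<le> u_bar u v \<pi>)"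
proof -
  obtain \<alpha> where \<alpha>: "\<alpha> \<in> BR v \<pi>" "\<forall>\<alpha>'\<in>BR v \<pi>. payoff u \<alpha>' \<pi> \<le> payoff u \<alpha> \<pi>"
    using continuous_attains_sup[OF compact_BR BR_nonempty continuous_on_payoff] by blast
  then have "u_bar u v \<pi> = payoff u \<alpha> \<pi>"
    unfolding u_bar_def by (intro cSup_eq_maximum) auto
  with \<alpha> show ?thesis by auto
qed

lemma u_bar_bounded:
  fixes u v :: "'a::finite \<Rightarrow> 'w::finite \<Rightarrow> real"
  shows "\<exists>B. \<forall>\<pi>\<in>prob_simplex. u_bar u v \<pi> \<le> B"
proof (intro exI ballI)
  fix \<pi> :: "real ^ 'w" assume \<pi>: "\<pi> \<in> prob_simplex"
  obtain \<alpha> where \<alpha>: "\<alpha> \<in> prob_simplex" "payoff u \<alpha> \<pi> = u_bar u v \<pi>"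
    using u_bar_attained[of v \<pi> u] by (auto simp: BR_def)
  have "\<alpha> $ a * \<pi> $ w * u a w \<le> \<bar>u a w\<bar>" for a w
  proof -
    have "0 \<le> \<alpha> $ a * \<pi> $ w" "\<alpha> $ a * \<pi> $ w \<le> 1"
      using \<alpha>(1) \<pi> by (auto simp: prob_simplex_le_1 prob_simplex_def intro!: mult_le_one)
    then have "\<alpha> $ a * \<pi> $ w * \<bar>u a w\<bar> \<le> \<bar>u a w\<bar>" "\<alpha> $ a * \<pi> $ w * u a w \<le> \<alpha> $ a * \<pi> $ w * \<bar>u a w\<bar>"
      by (auto intro: mult_left_le_one_le mult_left_mono)
    then show ?thesis by linarith
  qed
  then show "u_bar u v \<pi> \<le> (\<Sum>a\<in>UNIV. \<Sum>w\<in>UNIV. \<bar>u a w\<bar>)"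
    unfolding \<alpha>(2)[symmetric] payoff_def by (intro sum_mono)
qed

lemma cav_least:
  assumes "concave_on prob_simplex g" "\<forall>\<rho>\<in>prob_simplex. f \<rho> \<le> g \<rho>" "\<pi> \<in> prob_simplex"
  shows "cav f \<pi> \<le> g \<pi>"
  unfolding cav_def using assms by (intro cInf_lower) (auto intro!: bdd_belowI[where m="f \<pi>"])

lemma cav_greatest:
  assumes "\<forall>\<pi>\<in>prob_simplex. f \<pi> \<le> B"
    and "\<And>g. concave_on prob_simplex g \<Longrightarrow> \<forall>\<rho>\<in>prob_simplex. f \<rho> \<le> g \<rho> \<Longrightarrow> c \<le> g \<pi>"
  shows "c \<le> cav f \<pi>"
  unfolding cav_def
proof (intro cInf_greatest)
  have "concave_on prob_simplex (\<lambda>_ :: real ^ 'a. B)"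
    by (simp add: concave_on_const convex_prob_simplex)
  with assms(1) show
    "{g \<pi> | g. concave_on prob_simplex g \<and> (\<forall>\<rho>\<in>prob_simplex. f \<rho> \<le> g \<rho>)} \<noteq> {}"
    by blast
qed (use assms(2) in blast)

lemma cav_ge:
  assumes "\<forall>\<pi>\<in>prob_simplex. f \<pi> \<le> B" "\<pi> \<in> prob_simplex"
  shows "f \<pi> \<le> cav f \<pi>"
  using assms by (intro cav_greatest) auto

lemma cav_concave:
  assumes "\<forall>\<pi>\<in>prob_simplex. f \<pi> \<le> B"
  shows "concave_on prob_simplex (cav f)"
  unfolding concave_on_iff
proof (intro conjI ballI allI impI convex_prob_simplex)
  fix x y :: "real ^ 'a" and s t :: real
  assume xy: "x \<in> prob_simplex" "y \<in> prob_simplex" and st: "0 \<le> s" "0 \<le> t" "s + t = 1"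
  show "s * cav f x + t * cav f y \<le> cav f (s *\<^sub>R x + t *\<^sub>R y)"
  proof (rule cav_greatest[OF assms])
    fix g :: "real ^ 'a \<Rightarrow> real"
    assume g: "concave_on prob_simplex g" "\<forall>\<rho>\<in>prob_simplex. f \<rho> \<le> g \<rho>"
    have "s * cav f x + t * cav f y \<le> s * g x + t * g y"
      using g xy st by (intro add_mono mult_left_mono cav_least) auto
    also have "\<dots> \<le> g (s *\<^sub>R x + t *\<^sub>R y)"
      using g(1) xy st by (auto simp: concave_on_iff)
    finally show "s * cav f x + t * cav f y \<le> g (s *\<^sub>R x + t *\<^sub>R y)" .
  qed
qed

end

theory Submission
  imports Defs
begin

text \<open>Consider the game in which one player chooses a point \<open>(\<pi>, y)\<close> of the convex hull \<open>X\<close> of the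
  graph of \<open>u_bar\<close> over the posteriors and maximises \<open>u(\<alpha>, \<pi>) - y\<close>, while the other chooses
  \<open>\<alpha>\<close> and maximises \<open>v(\<alpha>, \<pi>)\<close>. An equilibrium exists: as the payoffs are bilinear, it is a solution
  of a variational inequality. In equilibrium \<open>\<alpha>\<close> is a best reply to \<open>\<pi>\<close>, so
  \<open>u(\<alpha>, \<pi>) \<le> u_bar \<pi> \<le> cav u_bar \<pi>\<close>. Optimality of the splitting forces the concavification to lie
  below \<open>X\<close>, so \<open>cav u_bar \<pi> \<le> y\<close>. Hence the first player's equilibrium payoff is at most \<open>0\<close>, and
  deviations to the points \<open>(\<pi>\<^sub>s, u_bar \<pi>\<^sub>s)\<close> give the claim.\<close>

text \<open>Brouwer applied to the map sending \<open>x\<close> to the projection of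
  \<open>x + F x\<close> onto \<open>K\<close>. At a fixed point, \<open>F x\<close> is the
  difference between a point and its projection, so it makes no acute angle with any direction
  \<open>y - x\<close> into \<open>K\<close>.\<close>

lemma variational_inequality:
  fixes F :: "'a::euclidean_space \<Rightarrow> 'a"
  assumes K: "compact K" "convex K" "K \<noteq> {}" and F: "continuous_on K F"
  shows "\<exists>x\<in>K. \<forall>y\<in>K. F x \<bullet> y \<le> F x \<bullet> x"
proof -
  have cl: "closed K" using K(1) by (rule compact_imp_closed)
  have "continuous_on K (\<lambda>x. closest_point K (x + F x))"
    by (rule continuous_on_compose2[OF continuous_on_closest_point[OF K(2) cl K(3)], where t=UNIV])
      (auto intro!: continuous_intros F)
  moreover have "(\<lambda>x. closest_point K (x + F x)) \<in> K \<rightarrow> K"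
    by (simp add: closest_point_in_set[OF cl K(3)])
  ultimately obtain x where x: "x \<in> K" "closest_point K (x + F x) = x"
    using brouwer[OF K] by blast
  have "F x \<bullet> y \<le> F x \<bullet> x" if "y \<in> K" for y
    using closest_point_dot[OF K(2) cl that, of "x + F x"] x(2) by (simp add: inner_diff_right)
  with x(1) show ?thesis by blast
qed

lemma convex_hull_image_weights:
  fixes f :: "'s \<Rightarrow> 'b::real_vector"
  assumes S: "finite S" and z: "z \<in> convex hull (f ` S)"
  shows "\<exists>w. (\<forall>s\<in>S. 0 \<le> w s) \<and> sum w S = 1 \<and> z = (\<Sum>s\<in>S. w s *\<^sub>R f s)"
proof -
  let ?C = "{z. \<exists>w. (\<forall>s\<in>S. 0 \<le> w s) \<and> sum w S = 1 \<and> z = (\<Sum>s\<in>S. w s *\<^sub>R f s)}"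
  have "convex hull (f ` S) \<subseteq> ?C"
  proof (rule hull_minimal)
    show "f ` S \<subseteq> ?C"
    proof clarify
      fix t assume t: "t \<in> S"
      have "(\<Sum>s\<in>S. (if s = t then 1 else 0) *\<^sub>R f s) = (\<Sum>s\<in>S. if s = t then f s else 0)"
        by (rule sum.cong) auto
      then show "\<exists>w. (\<forall>s\<in>S. 0 \<le> w s) \<and> sum w S = 1 \<and> f t = (\<Sum>s\<in>S. w s *\<^sub>R f s)"
        using S t by (intro exI[of _ "\<lambda>s. if s = t then 1 else 0"]) auto
    qed
    show "convex ?C"
    proof (rule convexI, clarify)
      fix a b :: real and w w' :: "'s \<Rightarrow> real"
      assume ab: "0 \<le> a" "0 \<le> b" "a + b = 1"
        and w: "\<forall>s\<in>S. 0 \<le> w s" "sum w S = 1" and w': "\<forall>s\<in>S. 0 \<le> w' s" "sum w' S = 1"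
      show "\<exists>w''. (\<forall>s\<in>S. 0 \<le> w'' s) \<and> sum w'' S = 1 \<and>
          a *\<^sub>R (\<Sum>s\<in>S. w s *\<^sub>R f s) + b *\<^sub>R (\<Sum>s\<in>S. w' s *\<^sub>R f s) = (\<Sum>s\<in>S. w'' s *\<^sub>R f s)"
        using ab w w' by (intro exI[of _ "\<lambda>s. a * w s + b * w' s"])
          (simp add: sum.distrib scaleR_add_left scaleR_sum_right flip: sum_distrib_left)
    qed
  qed
  with z show ?thesis by blast
qed

text \<open>If Jensen's inequality is tight for one system of positive weights, the reverse inequality
  holds for all weights \<open>w\<close>: a small multiple of \<open>w\<close> can be split off from \<open>l\<close>.\<close>

lemma concave_on_tight:
  fixes p :: "'s \<Rightarrow> 'b::real_vector"
  assumes g: "concave_on C g" and S: "finite S"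
    and p: "\<And>s. s \<in> S \<Longrightarrow> p s \<in> C" and y: "\<And>s. s \<in> S \<Longrightarrow> y s \<le> g (p s)"
    and l: "\<And>s. s \<in> S \<Longrightarrow> 0 < l s" "sum l S = 1"
    and tight: "(\<Sum>s\<in>S. l s * y s) = g (\<Sum>s\<in>S. l s *\<^sub>R p s)"
    and w: "\<And>s. s \<in> S \<Longrightarrow> 0 \<le> w s" "sum w S = 1"
  shows "g (\<Sum>s\<in>S. w s *\<^sub>R p s) \<le> (\<Sum>s\<in>S. w s * y s)"
proof -
  have ne: "S \<noteq> {}" using l(2) by auto
  \<comment> \<open>Halving keeps \<open>e\<close> strictly below every weight, hence below 1 even
    if \<open>S\<close> is a singleton, so division by \<open>1 - e\<close> is safe.\<close>
  define e where "e = Min (l ` S) / 2"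
  have e0: "0 < e" using S ne l(1) by (simp add: e_def)
  have el: "e < l s" if "s \<in> S" for s
  proof -
    have "Min (l ` S) \<le> l s" using S that by simp
    with e0 show ?thesis by (simp add: e_def)
  qed
  have e1: "e < 1"
  proof -
    obtain s where s: "s \<in> S" using ne by blast
    have "l s \<le> sum l S" using s S l(1) by (intro member_le_sum) (auto intro: less_imp_le)
    with el[OF s] l(2) show ?thesis by simp
  qed
  have ew: "e * w s \<le> l s" if "s \<in> S" for s
  proof -
    have "w s \<le> sum w S" using that S w(1) by (intro member_le_sum) auto
    then have "e * w s \<le> e" using w(2) e0 by simp
    with el[OF that] show ?thesis by simp
  qed
  \<comment> \<open>What remains of \<open>l\<close> after removing \<open>e * w\<close>,
    renormalised: \<open>l\<close> is the mixture of \<open>w\<close> and \<open>r\<close> with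
    weights \<open>e\<close> and \<open>1 - e\<close>.\<close>
  define r where "r s = (l s - e * w s) / (1 - e)" for s
  have r0: "0 \<le> r s" if "s \<in> S" for s using ew[OF that] e1 by (simp add: r_def)
  have lr: "l s = e * w s + (1 - e) * r s" for s using e1 by (simp add: r_def)
  have r1: "sum r S = 1"
    using e1 l(2) w(2) by (simp add: r_def sum_subtractf flip: sum_divide_distrib sum_distrib_left)
  let ?q = "\<Sum>s\<in>S. w s *\<^sub>R p s" and ?h = "\<Sum>s\<in>S. r s *\<^sub>R p s"
  have C: "convex C" using g by (simp add: concave_on_iff)
  have qh: "?q \<in> C" "?h \<in> C"
    using convex_sum[OF S C w(2)] convex_sum[OF S C r1] w(1) r0 p by auto
  \<comment> \<open>Jensen is applied to the \<open>r\<close> part only. By tightness the chain ends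
    in a sum with the same \<open>r\<close> term, which cancels and leaves \<open>e\<close> times
    the claim.\<close>
  have "e * g ?q + (1 - e) * (\<Sum>s\<in>S. r s * y s) \<le> e * g ?q + (1 - e) * (\<Sum>s\<in>S. r s * g (p s))"
    using e1 r0 y by (intro add_left_mono mult_left_mono sum_mono) auto
  also have "\<dots> \<le> e * g ?q + (1 - e) * g ?h"
    using e1 concave_on_sum[OF S ne g r1 r0 p] by (intro add_left_mono mult_left_mono) auto
  also have "\<dots> \<le> g (e *\<^sub>R ?q + (1 - e) *\<^sub>R ?h)"
    using g qh e0 e1 by (auto simp: concave_on_iff)
  also have "e *\<^sub>R ?q + (1 - e) *\<^sub>R ?h = (\<Sum>s\<in>S. l s *\<^sub>R p s)"
    by (simp add: lr scaleR_add_left scaleR_sum_right sum.distrib)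
  also have "g \<dots> = e * (\<Sum>s\<in>S. w s * y s) + (1 - e) * (\<Sum>s\<in>S. r s * y s)"
    unfolding tight[symmetric] sum_distrib_left sum.distrib[symmetric]
    by (rule sum.cong) (simp_all add: lr algebra_simps)
  finally show ?thesis using e0 by simp
qed

lemma payoff_eq_inner_belief: "payoff u \<alpha> \<pi> = (\<chi> \<omega>. \<Sum>a\<in>UNIV. \<alpha> $ a * u a \<omega>) \<bullet> \<pi>"
  unfolding payoff_def inner_vec_def
  by (subst sum.swap) (simp add: sum_distrib_left mult.commute mult.left_commute)

lemma payoff_eq_inner_action: "payoff v \<alpha> \<pi> = (\<chi> a. \<Sum>\<omega>\<in>UNIV. \<pi> $ \<omega> * v a \<omega>) \<bullet> \<alpha>"
  unfolding payoff_def inner_vec_def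
  by (simp add: sum_distrib_left mult.commute mult.left_commute)

lemma equilibrium_exists:
  fixes u v :: "'a::finite \<Rightarrow> 'w::finite \<Rightarrow> real"
  assumes X: "compact X" "convex X" "X \<noteq> {}"
  shows "\<exists>\<pi> y. (\<pi>, y) \<in> X \<and>
    (\<exists>\<alpha>\<in>BR v \<pi>. \<forall>(\<pi>', y')\<in>X. payoff u \<alpha> \<pi>' - y' \<le> payoff u \<alpha> \<pi> - y)"
proof -
  let ?Y = "prob_simplex :: (real ^ 'a) set"
  \<comment> \<open>Each player's payoff gradient in that player's own variable; the entry -1 comes
    from the term \<open>- y\<close>.\<close>
  define F :: "((real ^ 'w) \<times> real) \<times> (real ^ 'a) \<Rightarrow> _" where
    "F = (\<lambda>z. (((\<chi> \<omega>. \<Sum>a\<in>UNIV. snd z $ a * u a \<omega>), -1 :: real),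
               (\<chi> a. \<Sum>\<omega>\<in>UNIV. fst (fst z) $ \<omega> * v a \<omega>)))"
  have inner_F: "F ((\<pi>, y), \<alpha>) \<bullet> ((\<pi>', y'), \<alpha>') = payoff u \<alpha> \<pi>' - y' + payoff v \<alpha>' \<pi>"
    for \<pi> \<pi>' y y' \<alpha> \<alpha>'
    by (simp add: F_def payoff_eq_inner_belief[of u] payoff_eq_inner_action[of v])
  have "continuous_on (X \<times> ?Y) F" unfolding F_def by (intro continuous_intros)
  moreover have "compact (X \<times> ?Y)" "convex (X \<times> ?Y)" "X \<times> ?Y \<noteq> {}"
    using X by (auto intro: compact_Times convex_Times compact_prob_simplex convex_prob_simplex
        simp: prob_simplex_nonempty)
  ultimately obtain z where z: "z \<in> X \<times> ?Y" "\<forall>z'\<in>X \<times> ?Y. F z \<bullet> z' \<le> F z \<bullet> z"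
    using variational_inequality by metis
  obtain \<pi> y \<alpha> where zeq: "z = ((\<pi>, y), \<alpha>)" by (metis prod.exhaust)
  have dev: "payoff u \<alpha> \<pi>' - y' + payoff v \<alpha>' \<pi> \<le> payoff u \<alpha> \<pi> - y + payoff v \<alpha> \<pi>"
    if "(\<pi>', y') \<in> X" "\<alpha>' \<in> ?Y" for \<pi>' y' \<alpha>'
    using z(2) that unfolding zeq by (force simp: inner_F)
  have mem: "(\<pi>, y) \<in> X" "\<alpha> \<in> ?Y" using z(1) by (auto simp: zeq)
  \<comment> \<open>Letting one player deviate while the other stays put splits the joint inequality
    into the two equilibrium conditions.\<close>
  have "\<alpha> \<in> BR v \<pi>" using dev[OF mem(1)] mem(2) by (auto simp: BR_def)
  moreover have "\<forall>(\<pi>', y')\<in>X. payoff u \<alpha> \<pi>' - y' \<le> payoff u \<alpha> \<pi> - y"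
    using dev[OF _ mem(2)] by auto
  ultimately show ?thesis using mem(1) by blast
qed

theorem lemma1:
  fixes u v :: "'a::finite \<Rightarrow> 'w::finite \<Rightarrow> real"
    and \<pi>0 :: "real ^ 'w"
    and S :: "'s set" and l :: "'s \<Rightarrow> real" and p :: "'s \<Rightarrow> real ^ 'w"
  assumes "\<pi>0 \<in> prob_simplex"
    and "optimal_splitting u v \<pi>0 S l p"
  shows "\<exists>\<pi>p \<in> convex hull (posteriors S l p). \<exists>\<alpha>p \<in> BR v \<pi>p.
           \<forall>\<pi> \<in> posteriors S l p. payoff u \<alpha>p \<pi> \<le> u_bar u v \<pi>"
proof -
  let ?f = "u_bar u v"
  \<comment> \<open>Dropping the signals of weight 0 changes none of the sums and supplies the
    strict positivity that \<open>concave_on_tight\<close> requires.\<close>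
  define T where "T = {s \<in> S. 0 < l s}"
  have opt: "finite S" "\<forall>s\<in>S. 0 \<le> l s" "sum l S = 1" "\<forall>s\<in>S. p s \<in> prob_simplex"
    "(\<Sum>s\<in>S. l s *\<^sub>R p s) = \<pi>0" "(\<Sum>s\<in>S. l s * ?f (p s)) = cav ?f \<pi>0"
    using assms(2) by (auto simp: optimal_splitting_def)
  have T: "finite T" "T \<subseteq> S" using opt(1) by (auto simp: T_def)
  have l0: "l s = 0" if "s \<in> S - T" for s
    using that opt(2) by (force simp: T_def)
  have restr: "sum l T = sum l S" "(\<Sum>s\<in>T. l s *\<^sub>R p s) = (\<Sum>s\<in>S. l s *\<^sub>R p s)"
    "(\<Sum>s\<in>T. l s * ?f (p s)) = (\<Sum>s\<in>S. l s * ?f (p s))"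
    using T(2) l0 opt(1) by (auto intro!: sum.mono_neutral_left)
  have post: "posteriors S l p = p ` T" by (auto simp: posteriors_def T_def)
  obtain B where B: "\<forall>\<pi>\<in>prob_simplex. ?f \<pi> \<le> B" using u_bar_bounded by blast
  define G where "G = (\<lambda>s. (p s, ?f (p s)))"
  let ?X = "convex hull (G ` T)"
  have "T \<noteq> {}" using restr(1) opt(3) by auto
  then have "compact ?X" "convex ?X" "?X \<noteq> {}"
    using T(1) by (auto intro: finite_imp_compact_convex_hull)
  then obtain \<pi> y \<alpha> where eq: "(\<pi>, y) \<in> ?X" "\<alpha> \<in> BR v \<pi>"
      "\<forall>(\<pi>', y')\<in>?X. payoff u \<alpha> \<pi>' - y' \<le> payoff u \<alpha> \<pi> - y"
    using equilibrium_exists by metis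
  obtain w where w: "\<forall>s\<in>T. 0 \<le> w s" "sum w T = 1" "(\<pi>, y) = (\<Sum>s\<in>T. w s *\<^sub>R G s)"
    using convex_hull_image_weights[OF T(1) eq(1)] by blast
  \<comment> \<open>The same weights \<open>w\<close> represent both coordinates; this is what lets
    \<open>y\<close> be compared with \<open>cav\<close> at \<pi>.\<close>
  have \<pi>: "\<pi> = (\<Sum>s\<in>T. w s *\<^sub>R p s)" and y: "y = (\<Sum>s\<in>T. w s * ?f (p s))"
    using arg_cong[OF w(3), of fst] arg_cong[OF w(3), of snd]
    by (auto simp: G_def fst_sum snd_sum)
  have \<pi>hull: "\<pi> \<in> convex hull (p ` T)"
    unfolding \<pi> using w(1,2) T(1) by (intro convex_sum) (auto intro: hull_inc)
  have "\<pi> \<in> prob_simplex"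
    unfolding \<pi> using w(1,2) T opt(4) by (intro convex_sum convex_prob_simplex) auto
  then have "?f \<pi> \<le> cav ?f \<pi>" by (rule cav_ge[OF B])
  also have "\<dots> \<le> y"
    unfolding \<pi> y
  proof (rule concave_on_tight[OF cav_concave[OF B] T(1), where l = l])
    show "(\<Sum>s\<in>T. l s * ?f (p s)) = cav ?f (\<Sum>s\<in>T. l s *\<^sub>R p s)"
      using restr opt by simp
    show "?f (p s) \<le> cav ?f (p s)" if "s \<in> T" for s
      using that T(2) opt(4) by (intro cav_ge[OF B]) auto
  qed (use T w opt(3,4) restr(1) in \<open>auto simp: T_def\<close>)
  finally have "payoff u \<alpha> \<pi> \<le> y"
    using u_bar_attained[of v \<pi> u] eq(2) by fastforce
  moreover have "payoff u \<alpha> (p s) - ?f (p s) \<le> payoff u \<alpha> \<pi> - y" if "s \<in> T" for s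
    using eq(3) hull_inc[of "G s" "G ` T" convex] that by (fastforce simp: G_def)
  ultimately have "payoff u \<alpha> (p s) \<le> ?f (p s)" if "s \<in> T" for s
    using that by fastforce
  then show ?thesis
    unfolding post using \<pi>hull eq(2) by blast
qed

end
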